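(* Let $n\ge4$, $1\le k\le\ell\le n-2$, and let $M=M_n[k,\ell]$. Then for every index $m$, $$h_m^*(P_M)=h_m^*\big(P_{M_n[1,\ell]}\big)+h_m^*\big(P_{M_n[1,n-k-1]}\big)-h_m^*\big(P_{U_{2,n}}\big),$$ i.e. the $h^*$-vector of $M_n[k,\ell]$ is determined by $h^*$-vectors of rank-$2$ Schubert matroids and of $U_{2,n}$.
   Context: To a $2$-subset $B\subseteq[n]$ associate the monotone lattice path from $(0,0)$ to $(n-2,2)$ whose $i$-th step is north iff $i\in B$. For such paths $U$ weakly above $L$, $M[U,L]$ is the rank-$2$ matroid on $[n]$ whose bases are the $2$-subsets whose paths lie between $U$ and $L$. For $1\le k\le\ell\le n-2$, $M_n[k,\ell]=M[U,L]$ with $U=\{1,n-\ell\}$ and $L=\{n-k+1,n\}$; $U_{2,n}=M_n[1,n-2]$ is the uniform matroid of rank $2$ on $[n]$. For a matroid $N$, $P_N=\mathrm{conv}\{e_B:B\text{ a basis of }N\}$. For a lattice polytope $P$ of dimension $d$, the $h^*$-vector is defined by $\sum_{t\ge0}\#(tP\cap\mathbb{Z}^n)z^t=\frac{\sum_i h_i^*z^i}{(1-z)^{d+1}}$ (with $h_i^*=0$ beyond the degree).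
   Formalization: The lower path is taken to be L={n-k,n} instead of the printed L={n-k+1,n}, since the latter is not a 2-subset for k=1, which would leave M_n[1,ℓ], M_n[1,n-k-1] and U_{2,n}=M_n[1,n-2] undefined. *)

theory Defs
  imports
    "HOL-Analysis.Analysis"
    "HOL-Computational_Algebra.Formal_Power_Series"
begin

text \<open>The vertex reached after \<open>i\<close> steps of the path whose \<open>j\<close>-th step is north iff \<open>j \<in> B\<close>.\<close>
definition lattice_path :: "nat set \<Rightarrow> nat \<Rightarrow> nat \<times> nat" where
  "lattice_path B i = (card ({1..i} - B), card ({1..i} \<inter> B))"

text \<open>All paths meet the antidiagonal \<open>x + y = i\<close> in exactly one vertex (the \<open>i\<close>-th one), so
  paths are compared by the heights of these vertices.\<close>
definition weakly_above :: "nat \<Rightarrow> (nat \<Rightarrow> nat \<times> nat) \<Rightarrow> (nat \<Rightarrow> nat \<times> nat) \<Rightarrow> bool" where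
  "weakly_above n p q \<longleftrightarrow> (\<forall>i\<le>n. snd (q i) \<le> snd (p i))"

text \<open>Matroids on \<open>{1..n}\<close> are represented by their sets of bases.\<close>
definition lattice_path_matroid :: "nat \<Rightarrow> nat set \<Rightarrow> nat set \<Rightarrow> nat set set" where
  "lattice_path_matroid n U L =
     {B. B \<subseteq> {1..n} \<and> card B = 2 \<and>
         weakly_above n (lattice_path U) (lattice_path B) \<and>
         weakly_above n (lattice_path B) (lattice_path L)}"

text \<open>The upper path is \<open>N E\<^bsup>n-l-2\<^esup> N E\<^bsup>l\<^esup>\<close> and the lower one \<open>E\<^bsup>n-k-1\<^esup> N E\<^bsup>k-1\<^esup> N\<close>. The first
  north step of the lower path is thus step \<open>n - k\<close>, and not \<open>n - k + 1\<close>: the latter would not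
  give a \<open>2\<close>-subset for \<open>k = 1\<close>, and only the former makes \<open>k = 1\<close>, \<open>l = n - 2\<close> the uniform
  matroid.\<close>
definition lpm2 :: "nat \<Rightarrow> nat \<Rightarrow> nat \<Rightarrow> nat set set" where
  "lpm2 n k l = lattice_path_matroid n {1, n - l} {n - k, n}"

definition uniform_matroid :: "nat \<Rightarrow> nat \<Rightarrow> nat set set" where
  "uniform_matroid r n = {B. B \<subseteq> {1..n} \<and> card B = r}"

lemma lpm2_uniform:
  assumes "3 \<le> n"
  shows "lpm2 n 1 (n - 2) = uniform_matroid 2 n"
proof -
  have "weakly_above n (lattice_path {1, 2}) (lattice_path B) \<and>
        weakly_above n (lattice_path B) (lattice_path {n - 1, n})"
    if B: "B \<subseteq> {1..n}" "card B = 2" for B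
  proof -
    have fin: "finite B" using B(1) finite_subset by blast
    have up: "card ({1..i} \<inter> B) \<le> card ({1..i} \<inter> {1, 2})" for i :: nat
    proof -
      have "card ({1..i} \<inter> B) \<le> i" using card_mono[of "{1..i}" "{1..i} \<inter> B"] by simp
      moreover have "card ({1..i} \<inter> B) \<le> 2" using card_mono[of B "{1..i} \<inter> B"] fin B by simp
      moreover have "card ({1..i} \<inter> {1, 2}) = min i 2"
      proof (cases "i \<ge> 2")
        case True
        then have "{1..i} \<inter> {1, 2} = {1, 2}" by auto
        then show ?thesis using True by simp
      next
        case False
        then have "{1..i} \<inter> {1, 2} = {1..i}" by auto
        then show ?thesis using False by simp
      qed
      ultimately show ?thesis by simp
    qed
    have low: "card ({1..i} \<inter> {n - 1, n}) \<le> card ({1..i} \<inter> B)" if "i \<le> n" for i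
    proof -
      have "card B \<le> card (({1..i} \<inter> B) \<union> {i<..n})"
        by (rule card_mono) (use B fin in auto)
      also have "\<dots> \<le> card ({1..i} \<inter> B) + (n - i)"
        using card_Un_le[of "{1..i} \<inter> B" "{i<..n}"] by simp
      finally have h: "2 \<le> card ({1..i} \<inter> B) + (n - i)" using B by simp
      consider "i = n" | "i = n - 1" "i < n" | "i + 2 \<le> n" using \<open>i \<le> n\<close> by linarith
      then show ?thesis
      proof cases
        case 1
        then have "card ({1..i} \<inter> {n - 1, n}) \<le> card {n - 1, n}" by (intro card_mono) auto
        also have "\<dots> \<le> 2" by (simp add: card_insert_if)
        finally show ?thesis using h 1 by simp
      next
        case 2
        then have "card ({1..i} \<inter> {n - 1, n}) \<le> card {n - 1}" by (intro card_mono) auto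
        then show ?thesis using h 2 by simp
      next
        case 3
        then have "{1..i} \<inter> {n - 1, n} = {}" by auto
        then show ?thesis by (metis card.empty le0)
      qed
    qed
    show ?thesis using up low by (simp add: weakly_above_def lattice_path_def)
  qed
  moreover have "n - (n - 2) = 2" using assms by simp
  ultimately show ?thesis
    by (auto simp: lpm2_def lattice_path_matroid_def uniform_matroid_def)
qed

text \<open>\<open>pos\<close> labels the coordinates of \<open>real ^ 'n\<close> by \<open>{1..n}\<close>.\<close>
definition indicator_vec :: "('n \<Rightarrow> nat) \<Rightarrow> nat set \<Rightarrow> real ^ 'n" where
  "indicator_vec pos B = (\<chi> i. if pos i \<in> B then 1 else 0)"

definition matroid_polytope :: "('n::finite \<Rightarrow> nat) \<Rightarrow> nat set set \<Rightarrow> (real ^ 'n) set" where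
  "matroid_polytope pos \<B> = convex hull (indicator_vec pos ` \<B>)"

definition lattice_point_count :: "(real ^ 'n) set \<Rightarrow> nat \<Rightarrow> nat" where
  "lattice_point_count P t = card {x \<in> (\<lambda>y. real t *\<^sub>R y) ` P. \<forall>i. x $ i \<in> \<int>}"

definition ehrhart_series :: "(real ^ 'n) set \<Rightarrow> real fps" where
  "ehrhart_series P = Abs_fps (\<lambda>t. real (lattice_point_count P t))"

definition h_star_series :: "(real ^ 'n::finite) set \<Rightarrow> real fps" where
  "h_star_series P = ehrhart_series P * (1 - fps_X) ^ (nat (aff_dim P) + 1)"

lemma h_star_series_unique:
  "ehrhart_series P = h / (1 - fps_X) ^ (nat (aff_dim P) + 1) \<longleftrightarrow> h = h_star_series P"
proof -
  let ?q = "(1 - fps_X :: real fps) ^ (nat (aff_dim P) + 1)"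
  have unit: "fps_nth ?q 0 \<noteq> 0" by (simp add: fps_power_zeroth)
  then have "h / ?q = h * inverse ?q" by (rule fps_divide_unit)
  moreover have "inverse ?q * ?q = 1" using unit by (rule inverse_mult_eq_1)
  ultimately have "h / ?q * ?q = h" "ehrhart_series P * ?q / ?q = ehrhart_series P"
    using fps_divide_unit[OF unit, of "ehrhart_series P * ?q"]
    by (simp_all only: mult.assoc mult.commute[of ?q "inverse ?q"] mult_1_right)
  then show ?thesis unfolding h_star_series_def by metis
qed

definition h_star :: "(real ^ 'n::finite) set \<Rightarrow> nat \<Rightarrow> real" where
  "h_star P m = fps_nth (h_star_series P) m"

end

theory Submission
  imports Defs
begin

text \<open>
  A \<open>2\<close>-subset is a basis of \<open>M\<^sub>n[k,l]\<close> iff it is contained neither in the initial segment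
  \<open>S = {1..n-l-1}\<close> nor in the final segment \<open>T = {n-k+1..n}\<close>; that is, the parallel classes are
  \<open>S\<close>, \<open>T\<close> and singletons. There are at least three of them, so all four polytopes have
  dimension \<open>n - 1\<close> and it suffices to compare lattice point counts. By integer decomposition, the
  lattice points of the \<open>t\<close>-th dilate are the vectors in \<open>{0..t}\<^sup>n\<close> with coordinate sum \<open>2t\<close>
  whose sums over \<open>S\<close> and over \<open>T\<close> are at most \<open>t\<close>. The two sums cannot both exceed \<open>t\<close>, hence
  the points violating one of the two conditions are counted separately, and
  reversing the coordinates turns the condition on \<open>T\<close> into one on \<open>{1..k}\<close>.
\<close>

section \<open>Polytopes spanned by pairs from distinct classes: lattice points and
  dimension\<close>

definition class_sum :: "('n::finite \<Rightarrow> 'c) \<Rightarrow> ('n \<Rightarrow> 'a::comm_monoid_add) \<Rightarrow> 'c \<Rightarrow> 'a" where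
  "class_sum c w v = (\<Sum>i | c i = v. w i)"

text \<open>For nonconstant \<open>c\<close> these are the vertices of the base polytope of the
  loopless rank-2 matroid whose parallel classes are the nonempty fibres of
  \<open>c\<close>.\<close>

definition class_pairs :: "('n::finite \<Rightarrow> 'c) \<Rightarrow> (real ^ 'n) set" where
  "class_pairs c = {axis i 1 + axis j 1 | i j. c i \<noteq> c j}"

lemma class_sum_ge:
  fixes w :: "'n::finite \<Rightarrow> 'a::ordered_comm_monoid_add"
  assumes "\<And>i. 0 \<le> w i"
  shows "w i \<le> class_sum c w (c i)"
  using sum_mono2[of "{j. c j = c i}" "{i}" w] assms by (simp add: class_sum_def)

text \<open>One element is taken from each of the two heaviest classes; a third class of weight \<open>t + 1\<close>
  would make the total exceed \<open>2 (t + 1)\<close>.\<close>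
lemma exists_pair_of_heavy_classes:
  fixes w :: "'n::finite \<Rightarrow> nat"
  assumes total: "sum w UNIV = 2 * Suc t" and le: "\<And>v. class_sum c w v \<le> Suc t"
  obtains i j where "c i \<noteq> c j" "0 < w i" "0 < w j"
    "\<And>v. v \<noteq> c i \<Longrightarrow> v \<noteq> c j \<Longrightarrow> class_sum c w v \<le> t"
proof -
  let ?W = "class_sum c w"
  have heaviest: "\<exists>a\<in>A. \<forall>b\<in>A. ?W (c b) \<le> ?W (c a)" if "A \<noteq> {}" for A
  proof -
    have "Max ((\<lambda>i. ?W (c i)) ` A) \<in> (\<lambda>i. ?W (c i)) ` A" using that by (intro Max_in) auto
    then obtain a where "a \<in> A" "Max ((\<lambda>i. ?W (c i)) ` A) = ?W (c a)" by auto
    moreover have "?W (c b) \<le> Max ((\<lambda>i. ?W (c i)) ` A)" if "b \<in> A" for b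
      using that by (intro Max_ge) auto
    ultimately show ?thesis by auto
  qed
  obtain i0 where i0: "\<And>i. ?W (c i) \<le> ?W (c i0)" using heaviest[of UNIV] by auto
  let ?u = "c i0"
  \<comment> \<open>Otherwise the class \<open>?u\<close> would carry the whole weight, twice what a
    single class may carry.\<close>
  have "\<exists>i1. c i1 \<noteq> ?u \<and> 0 < w i1"
  proof (rule ccontr)
    assume "\<not> ?thesis"
    then have "sum w UNIV = ?W ?u"
      unfolding class_sum_def by (intro sum.mono_neutral_right) auto
    then show False using total le[of ?u] by simp
  qed
  then obtain i2 where i2: "c i2 \<noteq> ?u" "0 < w i2" by blast
  then have "{i. c i \<noteq> ?u} \<noteq> {}" by blast
  from heaviest[OF this] obtain i1
    where i1: "c i1 \<noteq> ?u" "\<And>i. c i \<noteq> ?u \<Longrightarrow> ?W (c i) \<le> ?W (c i1)" by auto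
  let ?v = "c i1"
  have posv: "0 < ?W ?v"
    using i1(2)[OF i2(1)] i2(2) class_sum_ge[of w i2 c] by simp
  have posu: "0 < ?W ?u" using posv i0[of i1] by simp
  have ex: "\<exists>i. c i = v \<and> 0 < w i" if "0 < ?W v" for v
  proof (rule ccontr)
    assume "\<not> ?thesis"
    then have "?W v = 0" by (auto simp: class_sum_def)
    then show False using that by simp
  qed
  \<comment> \<open>\<open>i0\<close> and \<open>i1\<close> only name the two classes and may
    themselves have weight zero, so elements of positive weight are chosen afresh.\<close>
  obtain i where i: "c i = ?u" "0 < w i" using ex[OF posu] by blast
  obtain j where j: "c j = ?v" "0 < w j" using ex[OF posv] by blast
  have "?W v \<le> t" if v: "v \<noteq> ?u" "v \<noteq> ?v" for v
  proof (rule ccontr)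
    assume "\<not> ?thesis"
    then have "Suc t \<le> ?W v" by simp
    moreover from this obtain h where h: "c h = v" using ex[of v] by auto
    moreover have "?W v \<le> ?W ?v" using i1(2)[of h] h v by simp
    moreover have "?W ?v \<le> ?W ?u" using i0 by simp
    ultimately have "3 * Suc t \<le> ?W v + ?W ?u + ?W ?v" by simp
    also have "?W v + ?W ?u = sum w ({i. c i = v} \<union> {i. c i = ?u})"
      unfolding class_sum_def by (rule sum.union_disjoint[symmetric]) (use v in auto)
    also have "\<dots> + ?W ?v = sum w ({i. c i = v} \<union> {i. c i = ?u} \<union> {i. c i = ?v})"
      unfolding class_sum_def by (rule sum.union_disjoint[symmetric]) (use v i1(1) in auto)
    also have "\<dots> \<le> sum w UNIV" by (rule sum_mono2) auto
    finally show False using total by simp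
  qed
  then show thesis using that[of i j] i j i1(1) by metis
qed

text \<open>Integer decomposition by induction on \<open>t\<close>: splitting off one suitable
  vertex \<open>axis i 1 + axis j 1\<close> leaves a weight vector that meets the bounds for the
  previous \<open>t\<close>.\<close>

lemma mem_dilate_class_polytope:
  fixes w :: "'n::finite \<Rightarrow> nat"
  assumes "sum w UNIV = 2 * t" "\<And>v. class_sum c w v \<le> t" "class_pairs c \<noteq> {}"
  shows "(\<chi> i. real (w i)) \<in> (\<lambda>y. real t *\<^sub>R y) ` (convex hull class_pairs c)"
  using assms
proof (induction t arbitrary: w)
  case 0
  then have "(\<chi> i. real (w i)) = 0" by (simp add: vec_eq_iff)
  \<comment> \<open>The zeroth dilate is the origin alone only if the polytope is nonempty.\<close>
  then show ?case using 0(3) by (auto simp: image_iff)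
next
  case (Suc t)
  obtain i j where ij: "c i \<noteq> c j" "0 < w i" "0 < w j"
    and rest: "\<And>v. v \<noteq> c i \<Longrightarrow> v \<noteq> c j \<Longrightarrow> class_sum c w v \<le> t"
    using exists_pair_of_heavy_classes[OF Suc.prems(1,2)] by blast
  \<comment> \<open>Truncated subtraction loses nothing: \<open>i\<close> and \<open>j\<close>
    differ and both have positive weight.\<close>
  define w' where "w' h = w h - (if h = i then 1 else 0) - (if h = j then 1 else 0)" for h
  have "i \<noteq> j" using ij(1) by auto
  then have w: "w h = w' h + (if h = i then 1 else 0) + (if h = j then 1 else 0)" for h
    using ij by (auto simp: w'_def)
  have "sum w UNIV = sum w' UNIV + 2" by (simp add: w sum.distrib)
  then have total: "sum w' UNIV = 2 * t" using Suc.prems(1) by simp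
  have "class_sum c w v = class_sum c w' v + (if v = c i then 1 else 0) + (if v = c j then 1 else 0)"
    for v
    by (simp add: class_sum_def w sum.distrib eq_commute)
  \<comment> \<open>The classes of \<open>i\<close> and \<open>j\<close> each lose one unit; every
    other class is already at most \<open>t\<close> by \<open>rest\<close>.\<close>
  then have "class_sum c w' v \<le> t" for v
    using Suc.prems(2)[of v] rest[of v] by (cases "v = c i"; cases "v = c j") auto
  then obtain y where y: "y \<in> convex hull class_pairs c" "(\<chi> i. real (w' i)) = real t *\<^sub>R y"
    using Suc.IH[OF total _ Suc.prems(3)] by blast
  let ?e = "axis i 1 + axis j 1 :: real ^ 'n"
  have e: "?e \<in> convex hull class_pairs c"
    by (rule hull_inc) (use ij(1) in \<open>auto simp: class_pairs_def\<close>)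
  let ?y = "(real t / real (Suc t)) *\<^sub>R y + (1 / real (Suc t)) *\<^sub>R ?e"
  have "?y \<in> convex hull class_pairs c"
    by (rule convexD[OF convex_convex_hull y(1) e]) (auto simp: field_simps)
  moreover have "(\<chi> i. real (w i)) = real (Suc t) *\<^sub>R ?y"
  proof -
    have "(\<chi> i. real (w i)) = (\<chi> i. real (w' i)) + ?e"
      by (simp add: vec_eq_iff w axis_def)
    also have "\<dots> = real (Suc t) *\<^sub>R ?y"
      unfolding y(2) by (simp add: scaleR_add_right)
    finally show ?thesis .
  qed
  ultimately show ?case by blast
qed

text \<open>All three conditions survive convex combinations and hold at the generators, whose two
  units lie in distinct classes.\<close>

lemma class_polytope_bounds:
  assumes "y \<in> convex hull class_pairs c"
  shows "0 \<le> y $ i" "(\<Sum>i\<in>UNIV. y $ i) = 2" "class_sum c (($) y) v \<le> 1"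
proof -
  let ?H = "{y :: real ^ 'a. (\<forall>i. 0 \<le> y $ i) \<and> (\<Sum>i\<in>UNIV. y $ i) = 2 \<and> (\<forall>v. class_sum c (($) y) v \<le> 1)}"
  have "convex ?H"
  proof (rule convexI)
    fix x y and a b :: real
    assume x: "x \<in> ?H" and y: "y \<in> ?H" and ab: "0 \<le> a" "0 \<le> b" "a + b = 1"
    have "class_sum c (($) (a *\<^sub>R x + b *\<^sub>R y)) v \<le> 1" for v
    proof -
      have "class_sum c (($) (a *\<^sub>R x + b *\<^sub>R y)) v
          = a * class_sum c (($) x) v + b * class_sum c (($) y) v"
        by (simp add: class_sum_def sum.distrib sum_distrib_left)
      also have "\<dots> \<le> 1" by (rule convex_bound_le) (use x y ab in auto)
      finally show ?thesis .
    qed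
    moreover have "(\<Sum>i\<in>UNIV. (a *\<^sub>R x + b *\<^sub>R y) $ i) = 2"
      using x y ab by (simp add: sum.distrib flip: sum_distrib_left)
    ultimately show "a *\<^sub>R x + b *\<^sub>R y \<in> ?H" using x y ab by auto
  qed
  moreover have "class_pairs c \<subseteq> ?H"
    by (auto simp: class_pairs_def class_sum_def axis_def sum.distrib)
  ultimately have "convex hull class_pairs c \<subseteq> ?H" by (rule hull_minimal[rotated])
  then show "0 \<le> y $ i" "(\<Sum>i\<in>UNIV. y $ i) = 2" "class_sum c (($) y) v \<le> 1"
    using assms by auto
qed

text \<open>One inclusion scales the bounds on the polytope; the other reads the coordinates as
  natural numbers and applies integer decomposition.\<close>

lemma lattice_points_class_polytope:
  assumes "class_pairs c \<noteq> {}"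
  shows "{x \<in> (\<lambda>y. real t *\<^sub>R y) ` (convex hull class_pairs c). \<forall>i. x $ i \<in> \<int>}
       = {x. (\<forall>i. x $ i \<in> \<int> \<and> 0 \<le> x $ i) \<and> (\<Sum>i\<in>UNIV. x $ i) = 2 * real t \<and>
             (\<forall>v. class_sum c (($) x) v \<le> real t)}" (is "?L = ?R")
proof (intro equalityI subsetI)
  fix x assume "x \<in> ?L"
  then obtain y where y: "y \<in> convex hull class_pairs c" "x = real t *\<^sub>R y" "\<forall>i. x $ i \<in> \<int>"
    by auto
  have "class_sum c (($) x) v = real t * class_sum c (($) y) v" for v
    by (simp add: y(2) class_sum_def sum_distrib_left)
  then show "x \<in> ?R"
    using class_polytope_bounds[OF y(1)] y(2,3)
    by (auto simp: mult_left_le simp flip: sum_distrib_left)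
next
  fix x assume x: "x \<in> ?R"
  then have "\<forall>i. \<exists>m::nat. x $ i = real m"
    by (metis (mono_tags, lifting) Ints_cases mem_Collect_eq of_int_0_le_iff of_int_of_nat_eq zero_le_imp_eq_int)
  then obtain w where w: "\<And>i. x $ i = real (w i)" by metis
  have "real (sum w UNIV) = real (2 * t)" using x w by simp
  then have "sum w UNIV = 2 * t" by (simp only: of_nat_eq_iff)
  moreover have "class_sum c w v \<le> t" for v
  proof -
    have "real (class_sum c w v) = class_sum c (($) x) v" by (simp add: class_sum_def w)
    then show ?thesis using x by (metis (mono_tags, lifting) mem_Collect_eq of_nat_le_iff)
  qed
  ultimately have "(\<chi> i. real (w i)) \<in> (\<lambda>y. real t *\<^sub>R y) ` (convex hull class_pairs c)"
    using mem_dilate_class_polytope assms by blast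
  moreover have "(\<chi> i. real (w i)) = x" by (simp add: vec_eq_iff w)
  ultimately show "x \<in> ?L" using x by auto
qed

text \<open>The hyperplane of coordinate sum \<open>2\<close> misses the origin, so the affine dimension is one less than
  the linear one; three distinct classes give \<open>2 e\<^sub>i = (e\<^sub>i + e\<^sub>j) + (e\<^sub>i + e\<^sub>h) - (e\<^sub>j + e\<^sub>h)\<close>.\<close>
lemma aff_dim_class_polytope:
  fixes c :: "'n::finite \<Rightarrow> 'c"
  assumes three: "\<And>i. \<exists>j h. c j \<noteq> c i \<and> c h \<noteq> c i \<and> c j \<noteq> c h"
  shows "aff_dim (convex hull class_pairs c) = int CARD('n) - 1"
proof -
  let ?G = "class_pairs c"
  have axis: "axis i 1 \<in> span ?G" for i
  proof -
    obtain j h where jh: "c j \<noteq> c i" "c h \<noteq> c i" "c j \<noteq> c h" using three by blast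
    have mem: "axis a 1 + axis b 1 \<in> span ?G" if "c a \<noteq> c b" for a b
      by (rule span_base) (use that in \<open>auto simp: class_pairs_def\<close>)
    have "(1/2) *\<^sub>R ((axis i 1 + axis j 1) + (axis i 1 + axis h 1) - (axis j 1 + axis h 1)) \<in> span ?G"
      by (intro span_mul span_add span_diff mem) (use jh in auto)
    also have "(1/2) *\<^sub>R ((axis i 1 + axis j 1) + (axis i 1 + axis h 1) - (axis j 1 + axis h 1))
        = (axis i 1 :: real ^ 'n)"
      by (simp add: vec_eq_iff)
    finally show ?thesis .
  qed
  have "(Basis :: (real ^ 'n) set) \<subseteq> span ?G" using axis by (auto simp: Basis_vec_def)
  then have "span ?G = UNIV" using span_Basis span_minimal subspace_span by blast
  then have dim: "dim ?G = CARD('n)" by (metis DIM_cart DIM_real dim_UNIV dim_span mult.right_neutral)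
  have "affine {x :: real ^ 'n. (\<chi> i. 1) \<bullet> x = 2}" by (rule affine_hyperplane)
  moreover have "?G \<subseteq> {x. (\<chi> i. 1) \<bullet> x = 2}"
    by (auto simp: class_pairs_def inner_vec_def axis_def sum.distrib)
  ultimately have "affine hull ?G \<subseteq> {x. (\<chi> i. 1) \<bullet> x = 2}" by (rule hull_minimal[rotated])
  then have "0 \<notin> affine hull ?G" by auto
  then have "aff_dim (insert 0 ?G) = aff_dim ?G + 1" by (simp add: aff_dim_insert)
  moreover have "aff_dim (insert 0 ?G) = int (dim (insert 0 ?G))"
    by (rule aff_dim_zero) (simp add: hull_inc)
  moreover have "dim (insert 0 ?G) = dim ?G" by (metis dim_span span_insert_0)
  ultimately show ?thesis using dim by (simp add: aff_dim_convex_hull)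
qed

section \<open>The matroids \<open>lpm2 n k l\<close> through their parallel classes\<close>

text \<open>Each path comparison is decided at one index: against the upper path at
  \<open>i = b\<close>, where \<open>{a, b}\<close> reaches height 2, and against the lower path at
  \<open>i = n - k\<close>, where that path reaches height 1.\<close>

lemma lpm2_bases:
  assumes "1 \<le> k" "k < n" "l \<le> n - 2" "2 \<le> n"
  shows "lpm2 n k l = {{a, b} | a b. 1 \<le> a \<and> a < b \<and> b \<le> n \<and> a \<le> n - k \<and> n - l \<le> b}"
proof -
  have card: "card ({1..i} \<inter> {a, b}) = (if a \<le> i then 1 else 0) + (if b \<le> i then 1 else 0)"
    if "1 \<le> a" "a < b" for a b i :: nat
  proof -
    have "{1..i} \<inter> {a, b} = (if a \<le> i then {a} else {}) \<union> (if b \<le> i then {b} else {})"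
      using that by auto
    then show ?thesis using that by simp
  qed
  have iff: "{a, b} \<in> lpm2 n k l \<longleftrightarrow> a \<le> n - k \<and> n - l \<le> b"
    if ab: "1 \<le> a" "a < b" "b \<le> n" for a b
  proof -
    have U: "(1::nat) < n - l" and L: "1 \<le> n - k" "n - k < n"
      using assms by auto
    have up: "weakly_above n (lattice_path {1, n - l}) (lattice_path {a, b}) \<longleftrightarrow> n - l \<le> b"
      unfolding weakly_above_def lattice_path_def snd_conv card[OF ab(1,2)] card[OF order_refl U]
    proof
      assume "\<forall>i\<le>n. (if a \<le> i then 1 else 0) + (if b \<le> i then 1 else 0)
            \<le> (if 1 \<le> i then 1 else 0) + (if n - l \<le> i then 1 else 0 :: nat)"
      from this[rule_format, OF ab(3)] show "n - l \<le> b" using ab by (auto split: if_splits)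
    qed (use ab in auto)
    have low: "weakly_above n (lattice_path {a, b}) (lattice_path {n - k, n}) \<longleftrightarrow> a \<le> n - k"
      unfolding weakly_above_def lattice_path_def snd_conv card[OF ab(1,2)] card[OF L]
    proof
      assume "\<forall>i\<le>n. (if n - k \<le> i then 1 else 0) + (if n \<le> i then 1 else 0)
            \<le> (if a \<le> i then 1 else 0) + (if b \<le> i then 1 else 0 :: nat)"
      from this[rule_format, of "n - k"] show "a \<le> n - k" using ab by (auto split: if_splits)
    qed (use ab in auto)
    show ?thesis using ab up low by (auto simp: lpm2_def lattice_path_matroid_def)
  qed
  have "\<exists>a b. B = {a, b} \<and> 1 \<le> a \<and> a < b \<and> b \<le> n" if "B \<in> lpm2 n k l" for B
  proof -
    have B: "B \<subseteq> {1..n}" "card B = 2" using that by (auto simp: lpm2_def lattice_path_matroid_def)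
    then obtain a b where "B = {a, b}" "a \<noteq> b" by (auto simp: card_2_iff)
    then have "{a, b} = {min a b, max a b}" "1 \<le> min a b" "min a b < max a b" "max a b \<le> n"
      using B(1) by auto
    then show ?thesis using \<open>B = {a, b}\<close> by metis
  qed
  then have "B \<in> lpm2 n k l \<longleftrightarrow>
      (\<exists>a b. B = {a, b} \<and> 1 \<le> a \<and> a < b \<and> b \<le> n \<and> a \<le> n - k \<and> n - l \<le> b)" for B
    using iff by metis
  then show ?thesis by blast
qed

text \<open>The labels \<open>0\<close> and \<open>n + 1\<close> are not elements of the ground set, so they do not clash with the
  labels of the singleton classes.\<close>
definition lpm2_class :: "nat \<Rightarrow> nat \<Rightarrow> nat \<Rightarrow> nat \<Rightarrow> nat" where
  "lpm2_class n k l a = (if a < n - l then 0 else if n - k < a then n + 1 else a)"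

lemma matroid_polytope_lpm2:
  fixes pos :: "'n::finite \<Rightarrow> nat"
  assumes pos: "bij_betw pos UNIV {1..n}" and "4 \<le> n" "1 \<le> k" "k \<le> l" "l \<le> n - 2"
  shows "matroid_polytope pos (lpm2 n k l)
    = convex hull class_pairs (\<lambda>i. lpm2_class n k l (pos i))"
proof -
  let ?c = "lpm2_class n k l"
  have inj: "inj pos" and range: "range pos = {1..n}" using pos by (auto simp: bij_betw_def)
  have vec: "indicator_vec pos {pos i, pos j} = axis i 1 + axis j 1" if "i \<noteq> j" for i j
    using that inj by (auto simp: indicator_vec_def vec_eq_iff axis_def inj_eq)
  \<comment> \<open>As \<open>a < b\<close>, both lie in the initial segment iff \<open>b\<close>
    does, and both in the final one iff \<open>a\<close> does; \<open>k \<le> l\<close> keeps the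
    segments disjoint.\<close>
  have class_ne: "?c a \<noteq> ?c b \<longleftrightarrow> a \<le> n - k \<and> n - l \<le> b" if "1 \<le> a" "a < b" "b \<le> n" for a b
    using that assms by (auto simp: lpm2_class_def)
  have bases: "lpm2 n k l = {{a, b} | a b. 1 \<le> a \<and> a < b \<and> b \<le> n \<and> a \<le> n - k \<and> n - l \<le> b}"
    by (rule lpm2_bases) (use assms in auto)
  have "indicator_vec pos ` lpm2 n k l = class_pairs (\<lambda>i. ?c (pos i))" (is "?L = ?R")
  proof (intro equalityI subsetI)
    fix x assume "x \<in> ?L"
    then obtain a b where ab: "1 \<le> a" "a < b" "b \<le> n" "a \<le> n - k" "n - l \<le> b"
      "x = indicator_vec pos {a, b}" unfolding bases by blast
    then obtain i j where ij: "a = pos i" "b = pos j"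
      using range by (metis atLeastAtMost_iff image_iff le_trans less_imp_le)
    then have "x = axis i 1 + axis j 1" using ab vec[of i j] by auto
    moreover have "?c (pos i) \<noteq> ?c (pos j)" using class_ne ab ij by blast
    ultimately show "x \<in> ?R" by (auto simp: class_pairs_def)
  next
    fix x assume "x \<in> ?R"
    then obtain i j where ij: "x = axis i 1 + axis j 1" "?c (pos i) \<noteq> ?c (pos j)"
      by (auto simp: class_pairs_def)
    then have x: "x = indicator_vec pos {pos i, pos j}" using vec[of i j] by metis
    have bnd: "1 \<le> pos h" "pos h \<le> n" for h using range by auto
    have mem: "{pos i, pos j} \<in> lpm2 n k l"
      if "?c (pos i) \<noteq> ?c (pos j)" "pos i < pos j" for i j
      unfolding bases using class_ne[of "pos i" "pos j"] that bnd by blast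
    have "{pos i, pos j} \<in> lpm2 n k l"
    proof (cases "pos i < pos j")
      case True
      then show ?thesis using mem ij(2) by blast
    next
      case False
      then have "pos j < pos i" using ij(2) by (metis linorder_neqE_nat)
      then have "{pos j, pos i} \<in> lpm2 n k l" using mem ij(2) by metis
      then show ?thesis by (simp only: insert_commute)
    qed
    then show "x \<in> ?L" using x by blast
  qed
  then show ?thesis by (simp add: matroid_polytope_def)
qed

text \<open>The elements \<open>1\<close>, \<open>n - l\<close> and \<open>n\<close> carry the
  distinct labels \<open>0\<close>, \<open>n - l\<close> and \<open>n + 1\<close>, and at most one
  of these is the label of \<open>pos i\<close>.\<close>

lemma lpm2_class_three:
  fixes pos :: "'n::finite \<Rightarrow> nat"
  assumes pos: "bij_betw pos UNIV {1..n}" and "4 \<le> n" "1 \<le> k" "k \<le> l" "l \<le> n - 2"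
  shows "\<exists>j h. lpm2_class n k l (pos j) \<noteq> lpm2_class n k l (pos i) \<and>
    lpm2_class n k l (pos h) \<noteq> lpm2_class n k l (pos i) \<and>
    lpm2_class n k l (pos j) \<noteq> lpm2_class n k l (pos h)"
proof -
  have range: "range pos = {1..n}" using pos by (auto simp: bij_betw_def)
  then have "1 \<in> range pos" "n - l \<in> range pos" "n \<in> range pos" using assms by auto
  then obtain i1 i2 i3 where i: "pos i1 = 1" "pos i2 = n - l" "pos i3 = n" by (metis imageE)
  have "lpm2_class n k l 1 = 0" using assms by (auto simp: lpm2_class_def)
  moreover have "lpm2_class n k l (n - l) = n - l" using assms by (auto simp: lpm2_class_def)
  moreover have "lpm2_class n k l n = n + 1" using assms by (auto simp: lpm2_class_def)
  moreover have "0 \<noteq> n - l" "n - l \<noteq> n + 1" "0 \<noteq> n + 1" using assms by auto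
  ultimately show ?thesis using i by metis
qed

section \<open>Lattice point counts of the dilates\<close>

text \<open>The lattice points of the \<open>t\<close>-th dilate of the second hypersimplex, the
  ambient set from which violating points are removed.\<close>

definition box_points :: "nat \<Rightarrow> (real ^ 'n::finite) set" where
  "box_points t = {x. (\<forall>i. x $ i \<in> \<int> \<and> 0 \<le> x $ i \<and> x $ i \<le> real t) \<and>
     (\<Sum>i\<in>UNIV. x $ i) = 2 * real t}"

definition heavy_points :: "('n::finite \<Rightarrow> nat) \<Rightarrow> nat \<Rightarrow> nat set \<Rightarrow> (real ^ 'n) set" where
  "heavy_points pos t S = {x \<in> box_points t. real t < (\<Sum>i | pos i \<in> S. x $ i)}"

lemma finite_box_points: "finite (box_points t :: (real ^ 'n::finite) set)"
proof -
  let ?V = "real_of_int ` {0..int t}"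
  have "(box_points t :: (real ^ 'n) set) \<subseteq> vec_lambda ` (UNIV \<rightarrow>\<^sub>E ?V)"
  proof
    fix x :: "real ^ 'n" assume x: "x \<in> box_points t"
    have "x $ i \<in> ?V" for i
    proof -
      obtain z where "x $ i = real_of_int z" using x by (auto simp: box_points_def elim: Ints_cases)
      moreover have "0 \<le> x $ i" "x $ i \<le> real t" using x by (auto simp: box_points_def)
      ultimately show ?thesis by auto
    qed
    then have "($) x \<in> UNIV \<rightarrow>\<^sub>E ?V" by auto
    then show "x \<in> vec_lambda ` (UNIV \<rightarrow>\<^sub>E ?V)" by (metis image_eqI vec_nth_inverse)
  qed
  then show ?thesis by (rule finite_subset) (intro finite_imageI finite_PiE; simp)
qed

text \<open>Coordinates are nonnegative with total \<open>2 * t\<close>, so two disjoint partial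
  sums cannot both exceed \<open>t\<close>.\<close>

lemma heavy_points_disjoint:
  assumes "S \<inter> T = {}"
  shows "heavy_points pos t S \<inter> heavy_points pos t T = {}"
proof -
  have "(\<Sum>i | pos i \<in> S. x $ i) + (\<Sum>i | pos i \<in> T. x $ i) \<le> 2 * real t"
    if "x \<in> box_points t" for x :: "real ^ 'a"
  proof -
    have "(\<Sum>i | pos i \<in> S. x $ i) + (\<Sum>i | pos i \<in> T. x $ i)
        = (\<Sum>i \<in> {i. pos i \<in> S} \<union> {i. pos i \<in> T}. x $ i)"
      by (rule sum.union_disjoint[symmetric]) (use assms in auto)
    also have "\<dots> \<le> (\<Sum>i\<in>UNIV. x $ i)"
      by (rule sum_mono2) (use that in \<open>auto simp: box_points_def\<close>)
    finally show ?thesis using that by (simp add: box_points_def)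
  qed
  then show ?thesis by (force simp: heavy_points_def)
qed

text \<open>Permuting coordinates preserves \<open>box_points t\<close>; reversal will thus trade a
  final segment for an initial one.\<close>

lemma card_heavy_points_permute:
  fixes pos :: "'n::finite \<Rightarrow> nat"
  assumes \<sigma>: "bij \<sigma>" and ST: "\<And>i. pos (\<sigma> i) \<in> S \<longleftrightarrow> pos i \<in> T"
  shows "card (heavy_points pos t S) = card (heavy_points pos t T)"
proof -
  let ?f = "\<lambda>x :: real ^ 'n. \<chi> i. x $ \<sigma> i"
  let ?g = "\<lambda>x :: real ^ 'n. \<chi> i. x $ inv \<sigma> i"
  have inv: "\<sigma> (inv \<sigma> i) = i" "inv \<sigma> (\<sigma> i) = i" for i
    using \<sigma> by (simp_all add: bij_is_surj surj_f_inv_f bij_is_inj)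
  have total: "(\<Sum>i\<in>UNIV. x $ \<sigma> i) = (\<Sum>i\<in>UNIV. x $ i)" for x :: "real ^ 'n"
    by (rule sum.reindex_bij_betw[OF \<sigma>])
  have total': "(\<Sum>i\<in>UNIV. x $ inv \<sigma> i) = (\<Sum>i\<in>UNIV. x $ i)" for x :: "real ^ 'n"
    by (rule sum.reindex_bij_betw[OF bij_imp_bij_inv[OF \<sigma>]])
  have part: "(\<Sum>i | pos i \<in> T. x $ \<sigma> i) = (\<Sum>i | pos i \<in> S. x $ i)" for x :: "real ^ 'n"
    by (rule sum.reindex_bij_witness[of _ "inv \<sigma>" \<sigma>]) (use inv in \<open>auto simp flip: ST\<close>)
  have part': "(\<Sum>i | pos i \<in> S. x $ inv \<sigma> i) = (\<Sum>i | pos i \<in> T. x $ i)" for x :: "real ^ 'n"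
    using part[of "?g x"] by (simp add: inv)
  have "bij_betw ?f (heavy_points pos t S) (heavy_points pos t T)"
    by (rule bij_betw_byWitness[of _ ?g])
      (auto simp: inv vec_eq_iff heavy_points_def box_points_def total total' part part')
  then show ?thesis by (rule bij_betw_same_card)
qed

text \<open>Classes other than the two segments are singletons or empty. Inside a segment, the bound
  on a single coordinate follows from the segment sum by nonnegativity.\<close>

lemma lpm2_class_sum_le_iff:
  fixes pos :: "'n::finite \<Rightarrow> nat" and x :: "real ^ 'n"
  assumes pos: "bij_betw pos UNIV {1..n}" and "4 \<le> n" "1 \<le> k" "k \<le> l" "l \<le> n - 2"
    and nonneg: "\<And>i. 0 \<le> x $ i"
  shows "(\<forall>v. class_sum (\<lambda>i. lpm2_class n k l (pos i)) (($) x) v \<le> real t) \<longleftrightarrow>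
    (\<forall>i. x $ i \<le> real t) \<and> (\<Sum>i | pos i \<in> {1..n - l - 1}. x $ i) \<le> real t \<and>
    (\<Sum>i | pos i \<in> {n - k + 1..n}. x $ i) \<le> real t" (is "?A \<longleftrightarrow> ?B")
proof -
  let ?c = "\<lambda>i. lpm2_class n k l (pos i)"
  have inj: "inj pos" using pos by (simp add: bij_betw_def)
  have bnd: "1 \<le> pos i" "pos i \<le> n" for i using pos by (auto simp: bij_betw_def)
  have "?c i = 0 \<longleftrightarrow> pos i \<in> {1..n - l - 1}" for i
    using bnd[of i] assms by (auto simp: lpm2_class_def)
  then have S: "class_sum ?c (($) x) 0 = (\<Sum>i | pos i \<in> {1..n - l - 1}. x $ i)"
    by (simp add: class_sum_def)
  have "?c i = n + 1 \<longleftrightarrow> pos i \<in> {n - k + 1..n}" for i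
    using bnd[of i] assms by (auto simp: lpm2_class_def)
  then have T: "class_sum ?c (($) x) (n + 1) = (\<Sum>i | pos i \<in> {n - k + 1..n}. x $ i)"
    by (simp add: class_sum_def)
  show ?thesis
  proof
    assume A: ?A
    have "x $ i \<le> real t" for i
      using class_sum_ge[of "($) x" i ?c] nonneg A by (meson order_trans)
    then show ?B using A S T by metis
  next
    assume B: ?B
    show ?A
    proof
      fix v
      consider "v = 0" | "v = n + 1" | "v \<noteq> 0" "v \<noteq> n + 1" by blast
      then show "class_sum ?c (($) x) v \<le> real t"
      proof cases
        case 3
        show ?thesis
        proof (cases "\<exists>i. ?c i = v")
          case True
          then obtain i where i: "?c i = v" by blast
          then have "{j. ?c j = v} = {i}"
            using 3 inj by (auto simp: lpm2_class_def inj_eq split: if_splits)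
          then show ?thesis using B by (simp add: class_sum_def)
        qed (simp add: class_sum_def)
      qed (use B S T in metis)+
    qed
  qed
qed

text \<open>For fixed \<open>n\<close> and \<open>t\<close>, one correction depends only on
  \<open>l\<close> and the other only on \<open>k\<close>; this separation yields the final
  identity. Real subtraction avoids truncation.\<close>

lemma lattice_point_count_lpm2:
  fixes pos :: "'n::finite \<Rightarrow> nat"
  assumes pos: "bij_betw pos UNIV {1..n}" and n: "4 \<le> n" "1 \<le> k" "k \<le> l" "l \<le> n - 2"
  shows "real (lattice_point_count (matroid_polytope pos (lpm2 n k l)) t)
    = real (card (box_points t :: (real ^ 'n) set))
      - real (card (heavy_points pos t {1..n - l - 1})) - real (card (heavy_points pos t {1..k}))"
proof -
  let ?c = "\<lambda>i. lpm2_class n k l (pos i)"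
  let ?S = "{1..n - l - 1}" and ?T = "{n - k + 1..n}"
  have "class_pairs ?c \<noteq> {}"
    using lpm2_class_three[OF assms] unfolding class_pairs_def by blast
  then have "{x \<in> (\<lambda>y. real t *\<^sub>R y) ` matroid_polytope pos (lpm2 n k l). \<forall>i. x $ i \<in> \<int>}
     = {x. (\<forall>i. x $ i \<in> \<int> \<and> 0 \<le> x $ i) \<and> (\<Sum>i\<in>UNIV. x $ i) = 2 * real t \<and>
             (\<forall>v. class_sum ?c (($) x) v \<le> real t)}"
    unfolding matroid_polytope_lpm2[OF assms] by (rule lattice_points_class_polytope)
  also have "\<dots> = box_points t - (heavy_points pos t ?S \<union> heavy_points pos t ?T)"
  proof (rule set_eqI)
    fix x :: "real ^ 'n"
    show "x \<in> {x. (\<forall>i. x $ i \<in> \<int> \<and> 0 \<le> x $ i) \<and> (\<Sum>i\<in>UNIV. x $ i) = 2 * real t \<and>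
             (\<forall>v. class_sum ?c (($) x) v \<le> real t)}
        \<longleftrightarrow> x \<in> box_points t - (heavy_points pos t ?S \<union> heavy_points pos t ?T)"
    \<comment> \<open>The class sum criterion needs nonnegative coordinates; with a negative one,
      both memberships fail.\<close>
    proof (cases "\<forall>i. 0 \<le> x $ i")
      case True
      then show ?thesis
        unfolding mem_Collect_eq lpm2_class_sum_le_iff[OF assms True[rule_format]]
        by (auto simp: box_points_def heavy_points_def not_less)
    qed (auto simp: box_points_def)
  qed
  finally have "lattice_point_count (matroid_polytope pos (lpm2 n k l)) t
      = card (box_points t - (heavy_points pos t ?S \<union> heavy_points pos t ?T))"
    by (simp add: lattice_point_count_def)
  moreover have sub: "heavy_points pos t S \<subseteq> box_points t" for S
    by (auto simp: heavy_points_def)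
  then have fin: "finite (heavy_points pos t S)" for S
    using finite_box_points by (rule finite_subset)
  have "heavy_points pos t ?S \<inter> heavy_points pos t ?T = {}"
    by (rule heavy_points_disjoint) (use n in auto)
  then have "card (heavy_points pos t ?S \<union> heavy_points pos t ?T)
      = card (heavy_points pos t ?S) + card (heavy_points pos t ?T)"
    by (rule card_Un_disjoint[OF fin fin])
  moreover have "real (card (box_points t - (heavy_points pos t ?S \<union> heavy_points pos t ?T)))
      = real (card (box_points t :: (real ^ 'n) set))
        - real (card (heavy_points pos t ?S \<union> heavy_points pos t ?T))"
    by (rule of_nat_diff[THEN trans[rotated], OF card_mono])
      (use sub fin in \<open>auto simp: finite_box_points card_Diff_subset\<close>)
  ultimately have count: "real (lattice_point_count (matroid_polytope pos (lpm2 n k l)) t)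
    = real (card (box_points t :: (real ^ 'n) set))
      - real (card (heavy_points pos t ?S) + card (heavy_points pos t ?T))"
    by simp
  have bnd: "1 \<le> pos i" "pos i \<le> n" for i using pos by (auto simp: bij_betw_def)
  \<comment> \<open>The reversal of the labels, transported to the index type; it exchanges
    \<open>?T\<close> and \<open>{1..k}\<close>.\<close>
  define \<sigma> where "\<sigma> i = inv_into UNIV pos (n + 1 - pos i)" for i
  have pos\<sigma>: "pos (\<sigma> i) = n + 1 - pos i" for i
    unfolding \<sigma>_def by (rule f_inv_into_f) (use pos bnd[of i] in \<open>auto simp: bij_betw_def\<close>)
  have "inj pos" using pos by (simp add: bij_betw_def)
  then have "\<sigma> (\<sigma> i) = i" for i
    using pos\<sigma>[of "\<sigma> i"] pos\<sigma>[of i] bnd[of i] by (simp add: inj_eq)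
  then have "bij \<sigma>" by (rule involuntory_imp_bij)
  moreover have "pos (\<sigma> i) \<in> ?T \<longleftrightarrow> pos i \<in> {1..k}" for i
    using bnd[of i] n by (auto simp: pos\<sigma>)
  ultimately have "card (heavy_points pos t ?T) = card (heavy_points pos t {1..k})"
    by (rule card_heavy_points_permute)
  then show ?thesis using count by simp
qed

theorem theorem6p11:
  fixes pos :: "'n::finite \<Rightarrow> nat" and n k l m :: nat
  assumes "bij_betw pos UNIV {1..n}"
    and "n \<ge> 4" and "1 \<le> k" and "k \<le> l" and "l \<le> n - 2"
  shows "h_star (matroid_polytope pos (lpm2 n k l)) m
       = h_star (matroid_polytope pos (lpm2 n 1 l)) m
         + h_star (matroid_polytope pos (lpm2 n 1 (n - k - 1))) m
         - h_star (matroid_polytope pos (uniform_matroid 2 n)) m"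
proof -
  let ?P = "\<lambda>k l. matroid_polytope pos (lpm2 n k l)"
  have U: "uniform_matroid 2 n = lpm2 n 1 (n - 2)" using lpm2_uniform[of n] assms by simp
  \<comment> \<open>The common dimension gives every Ehrhart series the same factor, so the identity
    can be proved on Ehrhart series.\<close>
  have h: "h_star_series (?P k l) = ehrhart_series (?P k l) * (1 - fps_X) ^ (nat (int CARD('n) - 1) + 1)"
    if "1 \<le> k" "k \<le> l" "l \<le> n - 2" for k l
    unfolding h_star_series_def matroid_polytope_lpm2[OF assms(1,2) that]
    by (subst aff_dim_class_polytope) (use lpm2_class_three[OF assms(1,2) that] in auto)
  have "ehrhart_series (?P k l)
      = ehrhart_series (?P 1 l) + ehrhart_series (?P 1 (n - k - 1)) - ehrhart_series (?P 1 (n - 2))"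
  proof (rule fps_ext)
    fix t
    \<comment> \<open>With b the number of box points and H(s) the number of those heavy on
      \<open>{1..s}\<close>, the right side is (b - H(n-l-1) - H(1)) + (b - H(k) - H(1)) - (b - H(1)
      - H(1)), and all H(1) cancel.\<close>
    have "n - (n - k - 1) - 1 = k" "n - (n - 2) - 1 = 1" using assms by auto
    moreover have "1 \<le> n - k - 1" "n - k - 1 \<le> n - 2" "1 \<le> n - 2" "1 \<le> l" using assms by auto
    ultimately show "fps_nth (ehrhart_series (?P k l)) t
      = fps_nth (ehrhart_series (?P 1 l) + ehrhart_series (?P 1 (n - k - 1)) - ehrhart_series (?P 1 (n - 2))) t"
      using assms by (simp add: ehrhart_series_def lattice_point_count_lpm2[OF assms(1,2)])
  qed
  moreover have "1 \<le> n - k - 1" "n - k - 1 \<le> n - 2" "1 \<le> n - 2" "1 \<le> l" using assms by auto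
  ultimately have "h_star_series (?P k l)
      = h_star_series (?P 1 l) + h_star_series (?P 1 (n - k - 1)) - h_star_series (?P 1 (n - 2))"
    using assms by (simp only: h order_refl distrib_right left_diff_distrib)
  then show ?thesis unfolding U h_star_def by simp
qed

end
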